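(* Let $N=2$ and let $\phi_{i,1}\in\mathbb{V}_0$, $i=1,2,3$, be orthogonal scaling functions satisfying $$\mathbb{V}_0=\operatorname{clos}_{L^2}\ \operatorname{span}\{\phi_{i,1}(\cdot-l):\ i=1,2,3,\ l\in\mathbb{Z}\}.$$ Then there exist non-zero functions $\psi_{i,1}\in\mathbb{W}_0$, $i=1,2,3$, orthogonal to $\phi_{j,1}$, $j=1,2,3$, and their integer translates.
   Context: **CHFIFs.** Let $N=2$, $x_0=0$, $x_1=\frac12$, $x_2=1$, $I=[0,1]$, $L_1(x)=\frac x2$, $L_2(x)=\frac{x+1}{2}$. Fix real parameters $\alpha_n,\gamma_n,\beta_n$ with $|\alpha_n|<1$, $|\gamma_n|<1$, $|\beta_n|+|\gamma_n|<1$, $n=1,2$. For $y,z\in\mathbb{R}^3$ let $f=(f_1,f_2):I\to\mathbb{R}^2$ be the unique continuous function satisfying, for all $x\in I$ and $n=1,2$, $$f_1(L_n(x))=\alpha_nf_1(x)+\beta_nf_2(x)+p_n(x),\qquad f_2(L_n(x))=\gamma_nf_2(x)+q_n(x),$$ where $p_n,q_n$ are the polynomials of degree at most one determined by $\alpha_ny_0+\beta_nz_0+p_n(0)=y_{n-1}$, $\gamma_nz_0+q_n(0)=z_{n-1}$, $\alpha_ny_2+\beta_nz_2+p_n(1)=y_n$, $\gamma_nz_2+q_n(1)=z_n$; then $f(x_i)=(y_i,z_i)$. The function $f_1$ is called a CHFIF (Coalescence Hidden-variable Fractal Interpolation Function) and $f_2$ an AFIF (Affine Fractal Interpolation Function).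 Let $\mathcal{S}_0$ be the vector space of all such $f$ as $y,z$ range over $\mathbb{R}^3$. **Spaces.** Let $\tilde{S}_0$ be the set of $f=(f_1,f_2):\mathbb{R}\to\mathbb{R}^2$ such that for every $i\in\mathbb{Z}$ the function $x\mapsto f(x+i-1)$, $x\in[0,1)$, is the restriction to $[0,1)$ of an element of $\mathcal{S}_0$. Let $\tilde{\mathbb{V}}_0$ be the set of $f\in\tilde{S}_0$ with $f_1,f_2\in L_2(\mathbb{R})\cap C_0(\mathbb{R})$, where $C_0(\mathbb{R})$ is the set of continuous real functions on $\mathbb{R}$ vanishing at infinity. Put $\mathbb{V}_0=\{f_1: f_1\text{ is the first component of some }f=(f_1,f_2)\in\tilde{\mathbb{V}}_0\}$ and $\mathbb{V}_k=\{f_1: f_1(2^{k}\,\cdot)\in\mathbb{V}_0\}$ for $k\in\mathbb{Z}$. The wavelet space $\mathbb{W}_k$ is the orthogonal complement of $\mathbb{V}_k$ in $\mathbb{V}_{k-1}$; in particular $\mathbb{W}_0$ is the orthogonal complement of $\mathbb{V}_0$ in $\mathbb{V}_{-1}$. **Conventions.** The inner product is $\langle g,h\rangle=\int_{\mathbb{R}}g(x)h(x)\,dx$. "Orthogonal scaling functions" means that $\phi_{1,1},\phi_{2,1},\phi_{3,1}$ are non-zero and the functions $\phi_{i,1}(\cdot-l)$, $i=1,2,3$, $l\in\mathbb{Z}$, are pairwise orthogonal. *)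

theory Defs
  imports "HOL-Analysis.Analysis" "HOL-Computational_Algebra.Polynomial"
begin

text \<open>
  Throughout, the parameters \<open>\<alpha> \<beta> \<gamma>\<close> are families indexed by \<open>n \<in> {1, 2}\<close> and the data \<open>y z\<close>
  are vectors of \<open>\<real>\<^sup>3\<close> indexed by \<open>{0, 1, 2}\<close>; values at other indices are never used.
\<close>

definition L_map :: "nat \<Rightarrow> real \<Rightarrow> real" where
  "L_map n x = (x + (real n - 1)) / 2"

definition CHFIF_polys ::
  "(nat \<Rightarrow> real) \<Rightarrow> (nat \<Rightarrow> real) \<Rightarrow> (nat \<Rightarrow> real) \<Rightarrow> (nat \<Rightarrow> real) \<Rightarrow> (nat \<Rightarrow> real)
    \<Rightarrow> (nat \<Rightarrow> real poly) \<Rightarrow> (nat \<Rightarrow> real poly) \<Rightarrow> bool" where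
  "CHFIF_polys \<alpha> \<beta> \<gamma> y z p q \<longleftrightarrow>
    (\<forall>n\<in>{1, 2}.
       degree (p n) \<le> 1 \<and> degree (q n) \<le> 1 \<and>
       \<alpha> n * y 0 + \<beta> n * z 0 + poly (p n) 0 = y (n - 1) \<and>
       \<gamma> n * z 0 + poly (q n) 0 = z (n - 1) \<and>
       \<alpha> n * y 2 + \<beta> n * z 2 + poly (p n) 1 = y n \<and>
       \<gamma> n * z 2 + poly (q n) 1 = z n)"

text \<open>
  Functions on \<open>I = [0, 1]\<close> are encoded as total functions of which only the values on \<open>{0..1}\<close>
  are constrained (and, below, used).
\<close>

definition is_CHFIF ::
  "(nat \<Rightarrow> real) \<Rightarrow> (nat \<Rightarrow> real) \<Rightarrow> (nat \<Rightarrow> real) \<Rightarrow> (nat \<Rightarrow> real) \<Rightarrow> (nat \<Rightarrow> real)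
    \<Rightarrow> (real \<Rightarrow> real \<times> real) \<Rightarrow> bool" where
  "is_CHFIF \<alpha> \<beta> \<gamma> y z f \<longleftrightarrow>
    continuous_on {0..1} f \<and>
    (\<exists>p q. CHFIF_polys \<alpha> \<beta> \<gamma> y z p q \<and>
      (\<forall>n\<in>{1, 2}. \<forall>x\<in>{0..1}.
         fst (f (L_map n x)) = \<alpha> n * fst (f x) + \<beta> n * snd (f x) + poly (p n) x \<and>
         snd (f (L_map n x)) = \<gamma> n * snd (f x) + poly (q n) x))"

definition S0 ::
  "(nat \<Rightarrow> real) \<Rightarrow> (nat \<Rightarrow> real) \<Rightarrow> (nat \<Rightarrow> real) \<Rightarrow> (real \<Rightarrow> real \<times> real) set" where
  "S0 \<alpha> \<beta> \<gamma> = {f. \<exists>y z. is_CHFIF \<alpha> \<beta> \<gamma> y z f}"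

definition S0_tilde ::
  "(nat \<Rightarrow> real) \<Rightarrow> (nat \<Rightarrow> real) \<Rightarrow> (nat \<Rightarrow> real) \<Rightarrow> (real \<Rightarrow> real \<times> real) set" where
  "S0_tilde \<alpha> \<beta> \<gamma> =
    {f. \<forall>i::int. \<exists>g\<in>S0 \<alpha> \<beta> \<gamma>. \<forall>x\<in>{0..<1}. f (x + of_int i - 1) = g x}"

text \<open>
  \<open>L\<^sub>2(\<real>)\<close> as a set of functions, not of almost-everywhere classes.
\<close>

definition L2_space :: "(real \<Rightarrow> real) set" where
  "L2_space = {g. g \<in> borel_measurable lborel \<and> integrable lborel (\<lambda>x. (g x)\<^sup>2)}"

definition L2_inner :: "(real \<Rightarrow> real) \<Rightarrow> (real \<Rightarrow> real) \<Rightarrow> real" where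
  "L2_inner g h = (LINT x|lborel. g x * h x)"

definition C0_space :: "(real \<Rightarrow> real) set" where
  "C0_space = {g. continuous_on UNIV g \<and> (g \<longlongrightarrow> 0) at_infinity}"

definition V0_tilde ::
  "(nat \<Rightarrow> real) \<Rightarrow> (nat \<Rightarrow> real) \<Rightarrow> (nat \<Rightarrow> real) \<Rightarrow> (real \<Rightarrow> real \<times> real) set" where
  "V0_tilde \<alpha> \<beta> \<gamma> =
    {f \<in> S0_tilde \<alpha> \<beta> \<gamma>. fst \<circ> f \<in> L2_space \<inter> C0_space \<and> snd \<circ> f \<in> L2_space \<inter> C0_space}"

definition V0 :: "(nat \<Rightarrow> real) \<Rightarrow> (nat \<Rightarrow> real) \<Rightarrow> (nat \<Rightarrow> real) \<Rightarrow> (real \<Rightarrow> real) set" where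
  "V0 \<alpha> \<beta> \<gamma> = (\<lambda>f. fst \<circ> f) ` V0_tilde \<alpha> \<beta> \<gamma>"

definition V ::
  "(nat \<Rightarrow> real) \<Rightarrow> (nat \<Rightarrow> real) \<Rightarrow> (nat \<Rightarrow> real) \<Rightarrow> int \<Rightarrow> (real \<Rightarrow> real) set" where
  "V \<alpha> \<beta> \<gamma> k = {g. (\<lambda>x. g (2 powi k * x)) \<in> V0 \<alpha> \<beta> \<gamma>}"

lemma V_zero: "V \<alpha> \<beta> \<gamma> 0 = V0 \<alpha> \<beta> \<gamma>"
  by (simp add: V_def)

definition W ::
  "(nat \<Rightarrow> real) \<Rightarrow> (nat \<Rightarrow> real) \<Rightarrow> (nat \<Rightarrow> real) \<Rightarrow> int \<Rightarrow> (real \<Rightarrow> real) set" where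
  "W \<alpha> \<beta> \<gamma> k = {g \<in> V \<alpha> \<beta> \<gamma> (k - 1). \<forall>h\<in>V \<alpha> \<beta> \<gamma> k. L2_inner g h = 0}"

definition translate :: "int \<Rightarrow> (real \<Rightarrow> real) \<Rightarrow> real \<Rightarrow> real" where
  "translate l g = (\<lambda>x. g (x - of_int l))"

definition lin_span :: "(real \<Rightarrow> real) set \<Rightarrow> (real \<Rightarrow> real) set" where
  "lin_span A = {(\<lambda>x. \<Sum>g\<in>T. c g * g x) |T c. finite T \<and> T \<subseteq> A}"

definition L2_clos :: "(real \<Rightarrow> real) set \<Rightarrow> (real \<Rightarrow> real) set" where
  "L2_clos A = {g \<in> L2_space. \<forall>\<epsilon>>0. \<exists>h\<in>A \<inter> L2_space. sqrt (LINT x|lborel. (g x - h x)\<^sup>2) < \<epsilon>}"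

text \<open>
  All square integrable representatives of the \<open>L\<^sub>2\<close> classes of the members of \<open>A\<close>. An \<open>L\<^sub>2\<close> closure
  is closed under changes on null sets, whereas \<open>V0\<close> consists of continuous functions, so the two
  are to be compared as sets of classes.
\<close>

definition L2_classes :: "(real \<Rightarrow> real) set \<Rightarrow> (real \<Rightarrow> real) set" where
  "L2_classes A = {g \<in> L2_space. \<exists>f\<in>A. AE x in lborel. g x = f x}"

definition orthogonal_scaling_functions :: "(nat \<Rightarrow> real \<Rightarrow> real) \<Rightarrow> bool" where
  "orthogonal_scaling_functions \<phi> \<longleftrightarrow>
    (\<forall>i\<in>{1, 2, 3}. \<phi> i \<noteq> (\<lambda>x. 0)) \<and>
    (\<forall>i\<in>{1, 2, 3}. \<forall>j\<in>{1, 2, 3}. \<forall>l m. (i, l) \<noteq> (j, m) \<longrightarrow>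
       L2_inner (translate l (\<phi> i)) (translate m (\<phi> j)) = 0)"

end

theory Submission
  imports Defs
begin

text \<open>
  Members of \<open>W 0\<close> are orthogonal to \<open>V0\<close>, and \<open>V0\<close> contains the translates of the \<open>\<phi> j\<close>. So it is
  enough to find one non-zero function in \<open>W 0\<close>, which can serve as every \<open>\<psi> i\<close>. Such a function
  exists with compact support because \<open>V (- 1)\<close>, being the dilated copy of \<open>V0\<close>, has asymptotically
  twice as many degrees of freedom per unit length as \<open>V0\<close>.

  To make the count precise, fix the bump \<open>\<Lambda> = fractal_bump \<alpha>\<close> (the CHFIF with \<open>f\<^sub>2 = 0\<close> and data
  \<open>y = (0, 1, 0)\<close>) and the bump \<open>U = hidden_bump \<alpha> \<beta> \<gamma>\<close> (the first component of the CHFIF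
  with data \<open>y = 0\<close>, \<open>z = (0, 1, 0)\<close>). Affine functions solve the functional equations for suitable
  polynomials \<open>p\<close> and \<open>q\<close>, so subtracting an affine function and multiples of the bumps reduces any
  CHFIF to one whose data vanish; this one is \<open>0\<close> since the functional equation is a
  contraction (\<open>self_affine_zero_unique\<close>). Hence every first component is an affine function plus
  \<open>e \<Lambda> + d U\<close> (\<open>S0_local_form\<close>). Here \<open>U\<close> may be zero, for instance if \<open>\<beta> = 0\<close>.

  By continuity at the integers, \<open>V0\<close> on \<open>[0, n)\<close> is spanned by \<open>n + 1\<close> piecewise linear tents and
  \<open>n\<close> translates each of \<open>\<Lambda>\<close> and \<open>U\<close> (\<open>V0_expansion\<close>), that is by \<open>3 n + 1\<close> functions. On the other
  side, already the functions of \<open>V (- 1)\<close> built from tents and \<open>\<Lambda>\<close> alone, with support in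
  \<open>[0, n]\<close>, form a space of dimension \<open>(2 n - 1) + 2 n = 4 n - 1\<close>. For \<open>n = 3\<close> orthogonality to \<open>V0\<close>
  follows from \<open>10\<close> homogeneous linear equations in \<open>11\<close> unknowns, which have a non-trivial solution
  (\<open>W0_nontrivial\<close>). Leaving \<open>U\<close> out on one side and keeping it on the other makes the
  count independent of whether \<open>U\<close> vanishes.
\<close>

section \<open>Underdetermined linear systems\<close>

text \<open>Gaussian elimination of one unknown per equation.\<close>

lemma underdetermined_system_nontrivial:
  fixes a :: "'i \<Rightarrow> 'j \<Rightarrow> real"
  assumes "finite J" "finite I" "card J < card I"
  shows "\<exists>c. (\<exists>i\<in>I. c i \<noteq> 0) \<and> (\<forall>j\<in>J. (\<Sum>i\<in>I. c i * a i j) = 0)"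
  using assms
proof (induction J arbitrary: I a rule: finite_induct)
  case empty
  then have "I \<noteq> {}" by auto
  then show ?case by (intro exI[of _ "\<lambda>_. 1"]) auto
next
  case (insert j J)
  show ?case
  proof (cases "\<forall>i\<in>I. a i j = 0")
    case True
    obtain c where "\<exists>i\<in>I. c i \<noteq> 0" "\<forall>j\<in>J. (\<Sum>i\<in>I. c i * a i j) = 0"
      using insert.IH[of I a] insert.prems insert.hyps by auto
    with True show ?thesis by (intro exI[of _ c]) auto
  next
    case False
    then obtain k where k: "k \<in> I" "a k j \<noteq> 0" by auto
    \<comment> \<open>Solve equation \<open>j\<close> for the unknown \<open>k\<close> and substitute into the others.\<close>
    define a' where "a' i l = a i l - a i j / a k j * a k l" for i l
    have "card J < card (I - {k})"
      using insert.prems insert.hyps k by simp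
    then obtain c where c: "\<exists>i\<in>I - {k}. c i \<noteq> 0"
        "\<And>l. l \<in> J \<Longrightarrow> (\<Sum>i\<in>I - {k}. c i * a' i l) = 0"
      using insert.IH[of "I - {k}" a'] insert.prems by auto
    define t where "t = - (\<Sum>i\<in>I - {k}. c i * a i j) / a k j"
    have split: "(\<Sum>i\<in>I. (c(k := t)) i * a i l) = t * a k l + (\<Sum>i\<in>I - {k}. c i * a i l)" for l
      using insert.prems(1) k by (subst sum.remove[of _ k]) auto
    have "(\<Sum>i\<in>I. (c(k := t)) i * a i l) = 0" if l: "l \<in> insert j J" for l
    proof (cases "l = j")
      case True
      then show ?thesis using k by (subst split) (simp add: t_def)
    next
      case False
      have "0 = (\<Sum>i\<in>I - {k}. c i * a i l - (c i * a i j) * (a k l / a k j))"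
        using c(2)[of l] l False by (simp add: a'_def algebra_simps)
      also have "\<dots> = (\<Sum>i\<in>I - {k}. c i * a i l) + t * a k l"
        by (simp add: sum_subtractf sum_distrib_right sum_divide_distrib t_def)
      finally show ?thesis by (subst split) simp
    qed
    moreover have "\<exists>i\<in>I. (c(k := t)) i \<noteq> 0" using c(1) by auto
    ultimately show ?thesis by blast
  qed
qed

section \<open>Self-affine bumps\<close>

text \<open>
  A solution of \<open>f x = b x + a 1 * f (2 x) + a 2 * f (2 x - 1)\<close> that vanishes outside \<open>[0, 1]\<close>
  is the Neumann series of this fixed point equation, with the terms below.
\<close>

primrec bump_term :: "(nat \<Rightarrow> real) \<Rightarrow> (real \<Rightarrow> real) \<Rightarrow> nat \<Rightarrow> real \<Rightarrow> real" where
  "bump_term a b 0 = b"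
| "bump_term a b (Suc k) = (\<lambda>x. a 1 * bump_term a b k (2 * x) + a 2 * bump_term a b k (2 * x - 1))"

definition self_affine :: "(nat \<Rightarrow> real) \<Rightarrow> (real \<Rightarrow> real) \<Rightarrow> real \<Rightarrow> real" where
  "self_affine a b x = (\<Sum>k. bump_term a b k x)"

definition bump :: "(real \<Rightarrow> real) \<Rightarrow> bool" where
  "bump b \<longleftrightarrow> continuous_on UNIV b \<and> (\<forall>x. x \<le> 0 \<or> 1 \<le> x \<longrightarrow> b x = 0)"

lemma bump_zero: "bump b \<Longrightarrow> x \<le> 0 \<or> 1 \<le> x \<Longrightarrow> b x = 0"
  by (auto simp: bump_def)

lemma bump_continuous: "bump b \<Longrightarrow> continuous_on UNIV b"
  by (auto simp: bump_def)

lemma bump_two_scale: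
  assumes "bump f" "bump g"
  shows "bump (\<lambda>x. s * f (2 * x) + t * g (2 * x - 1))"
  unfolding bump_def
proof (intro conjI allI impI)
  have "continuous_on UNIV (\<lambda>x. f (2 * x))" "continuous_on UNIV (\<lambda>x. g (2 * x - 1))"
    by (rule continuous_on_compose2[OF bump_continuous];
        use assms in \<open>auto intro: continuous_intros\<close>)+
  then show "continuous_on UNIV (\<lambda>x. s * f (2 * x) + t * g (2 * x - 1))"
    by (intro continuous_intros)
next
  fix x :: real
  assume "x \<le> 0 \<or> 1 \<le> x"
  then have "2 * x \<le> 0 \<or> 1 \<le> 2 * x" "2 * x - 1 \<le> 0 \<or> 1 \<le> 2 * x - 1" by auto
  then show "s * f (2 * x) + t * g (2 * x - 1) = 0"
    using assms by (simp add: bump_zero)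
qed

lemma bump_bump_term: "bump b \<Longrightarrow> bump (bump_term a b k)"
  by (induction k) (simp_all add: bump_two_scale)

text \<open>
  Two summands enter each step but the factor is \<open>s\<close> and not \<open>2 s\<close>: \<open>f (2 x)\<close> and \<open>f (2 x - 1)\<close>
  live on the two different halves of \<open>[0, 1]\<close>.
\<close>

lemma bump_term_bound:
  assumes b: "bump b" and M: "\<And>x. \<bar>b x\<bar> \<le> M" and s: "\<bar>a 1\<bar> \<le> s" "\<bar>a 2\<bar> \<le> s"
  shows "\<bar>bump_term a b k x\<bar> \<le> s ^ k * M"
proof (induction k arbitrary: x)
  case 0
  then show ?case using M by simp
next
  case (Suc k)
  let ?d = "bump_term a b k"
  have s0: "0 \<le> s" using s by linarith
  have step: "\<bar>c * ?d y\<bar> \<le> s * (s ^ k * M)" if "\<bar>c\<bar> \<le> s" for c y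
    using mult_mono[OF that Suc.IH[of y] s0] by (simp add: abs_mult)
  show ?case
  proof (cases "x \<le> 1 / 2")
    case True
    then have "?d (2 * x - 1) = 0" by (intro bump_zero[OF bump_bump_term[OF b]]) auto
    then show ?thesis using step[OF s(1), of "2 * x"] by (simp add: mult_ac)
  next
    case False
    then have "?d (2 * x) = 0" by (intro bump_zero[OF bump_bump_term[OF b]]) auto
    then show ?thesis using step[OF s(2), of "2 * x - 1"] by (simp add: mult_ac)
  qed
qed

text \<open>
  The bound above makes the series converge uniformly, so continuity passes to the sum, and
  shifting the summation index yields the functional equation.
\<close>

lemma
  assumes b: "bump b" and a: "\<bar>a 1\<bar> < 1" "\<bar>a 2\<bar> < 1"
  shows bump_self_affine: "bump (self_affine a b)"
    and self_affine_eq: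
      "self_affine a b x = b x + a 1 * self_affine a b (2 * x) + a 2 * self_affine a b (2 * x - 1)"
proof -
  define s where "s = max \<bar>a 1\<bar> \<bar>a 2\<bar>"
  have s: "\<bar>a 1\<bar> \<le> s" "\<bar>a 2\<bar> \<le> s" "0 \<le> s" "s < 1" using a by (auto simp: s_def)
  have "bounded (b ` {0..1})"
    by (intro compact_imp_bounded compact_continuous_image continuous_on_subset[OF bump_continuous[OF b]]) auto
  then obtain M where M0: "\<And>x. x \<in> {0..1} \<Longrightarrow> \<bar>b x\<bar> \<le> M"
    unfolding bounded_iff by fastforce
  have M: "\<bar>b x\<bar> \<le> M" for x
  proof (cases "x \<in> {0..1}")
    case False
    then have "b x = 0" by (intro bump_zero[OF b]) auto
    then show ?thesis using M0[of 0] by auto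
  qed (rule M0)
  have bound: "norm (bump_term a b k x) \<le> s ^ k * M" for k x
    using bump_term_bound[OF b M s(1,2)] by simp
  have sM: "summable (\<lambda>k. s ^ k * M)"
    using s by (intro summable_mult2 summable_geometric) auto
  have sum: "summable (\<lambda>k. bump_term a b k x)" for x
    by (rule summable_comparison_test'[OF sM bound])
  have "uniform_limit UNIV (\<lambda>n x. \<Sum>k<n. bump_term a b k x) (self_affine a b) sequentially"
    unfolding self_affine_def by (rule Weierstrass_m_test[OF bound sM])
  then have "continuous_on UNIV (self_affine a b)"
    by (rule uniform_limit_theorem[rotated])
       (auto intro!: always_eventually continuous_on_sum bump_continuous[OF bump_bump_term[OF b]])
  moreover have "self_affine a b x = 0" if "x \<le> 0 \<or> 1 \<le> x" for x
    using bump_zero[OF bump_bump_term[OF b] that] by (simp add: self_affine_def)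
  ultimately show "bump (self_affine a b)" by (auto simp: bump_def)
  have "self_affine a b x = b x + (\<Sum>k. bump_term a b (Suc k) x)"
    using suminf_split_head[OF sum] by (simp add: self_affine_def)
  also have "(\<Sum>k. bump_term a b (Suc k) x) =
      a 1 * self_affine a b (2 * x) + a 2 * self_affine a b (2 * x - 1)"
    by (simp add: self_affine_def suminf_add[symmetric] suminf_mult sum summable_mult)
  finally show "self_affine a b x = b x + a 1 * self_affine a b (2 * x) + a 2 * self_affine a b (2 * x - 1)"
    by simp
qed

text \<open>On \<open>[0, 1]\<close> one of the two terms drops out on either half, which is the form in \<open>is_CHFIF\<close>.\<close>

lemma self_affine_halves:
  assumes b: "bump b" and a: "\<bar>a 1\<bar> < 1" "\<bar>a 2\<bar> < 1" and x: "x \<in> {0..1}"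
  shows "self_affine a b (x / 2) = a 1 * self_affine a b x + b (x / 2)"
    and "self_affine a b ((x + 1) / 2) = a 2 * self_affine a b x + b ((x + 1) / 2)"
proof -
  note z = bump_zero[OF bump_self_affine[OF b a]]
  have "self_affine a b (x - 1) = 0" "self_affine a b (x + 1) = 0"
    using x by (auto intro!: z)
  then show "self_affine a b (x / 2) = a 1 * self_affine a b x + b (x / 2)"
      "self_affine a b ((x + 1) / 2) = a 2 * self_affine a b x + b ((x + 1) / 2)"
    by (subst self_affine_eq[OF b a], simp add: add_divide_distrib)+
qed

definition tent :: "real \<Rightarrow> real" where
  "tent x = max 0 (1 - \<bar>x\<bar>)"

text \<open>
  For \<open>a = \<alpha>\<close> the CHFIF with hidden component \<open>0\<close> and data \<open>y = (0, 1, 0)\<close>, for \<open>a = \<gamma>\<close> the AFIF with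
  data \<open>z = (0, 1, 0)\<close>, both extended by \<open>0\<close>.
\<close>

definition fractal_bump :: "(nat \<Rightarrow> real) \<Rightarrow> real \<Rightarrow> real" where
  "fractal_bump a = self_affine a (\<lambda>x. tent (2 * x - 1))"

text \<open>
  The CHFIF with \<open>y = 0\<close> whose hidden component is \<open>fractal_bump \<gamma>\<close>; for these data the polynomials
  \<open>p\<close> are \<open>0\<close>.
\<close>

definition hidden_bump :: "(nat \<Rightarrow> real) \<Rightarrow> (nat \<Rightarrow> real) \<Rightarrow> (nat \<Rightarrow> real) \<Rightarrow> real \<Rightarrow> real" where
  "hidden_bump \<alpha> \<beta> \<gamma> =
    self_affine \<alpha> (\<lambda>x. \<beta> 1 * fractal_bump \<gamma> (2 * x) + \<beta> 2 * fractal_bump \<gamma> (2 * x - 1))"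

lemma continuous_tent: "continuous_on UNIV tent"
  unfolding tent_def by (intro continuous_intros)

lemma bump_tent: "bump (\<lambda>x. tent (2 * x - 1))"
  unfolding bump_def tent_def by (auto intro!: continuous_intros)

context
  fixes \<alpha> :: "nat \<Rightarrow> real"
  assumes \<alpha>: "\<bar>\<alpha> 1\<bar> < 1" "\<bar>\<alpha> 2\<bar> < 1"
begin

lemma bump_fractal_bump: "bump (fractal_bump \<alpha>)"
  unfolding fractal_bump_def by (rule bump_self_affine[OF bump_tent \<alpha>])

lemma fractal_bump_halves:
  assumes "x \<in> {0..1}"
  shows "fractal_bump \<alpha> (x / 2) = \<alpha> 1 * fractal_bump \<alpha> x + x"
    and "fractal_bump \<alpha> ((x + 1) / 2) = \<alpha> 2 * fractal_bump \<alpha> x + (1 - x)"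
  using self_affine_halves[OF bump_tent \<alpha> assms] assms
  by (auto simp: fractal_bump_def tent_def add_divide_distrib)

lemma fractal_bump_mid: "fractal_bump \<alpha> (1 / 2) = 1"
  using fractal_bump_halves(1)[of 1] bump_zero[OF bump_fractal_bump, of 1] by simp

end

context
  fixes \<alpha> \<beta> \<gamma> :: "nat \<Rightarrow> real"
  assumes \<alpha>: "\<bar>\<alpha> 1\<bar> < 1" "\<bar>\<alpha> 2\<bar> < 1" and \<gamma>: "\<bar>\<gamma> 1\<bar> < 1" "\<bar>\<gamma> 2\<bar> < 1"
begin

lemma bump_hidden_bump: "bump (hidden_bump \<alpha> \<beta> \<gamma>)"
  unfolding hidden_bump_def
  by (intro bump_self_affine bump_two_scale bump_fractal_bump \<alpha> \<gamma>)

lemma hidden_bump_halves: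
  assumes x: "x \<in> {0..1}"
  shows "hidden_bump \<alpha> \<beta> \<gamma> (x / 2) = \<alpha> 1 * hidden_bump \<alpha> \<beta> \<gamma> x + \<beta> 1 * fractal_bump \<gamma> x"
    and "hidden_bump \<alpha> \<beta> \<gamma> ((x + 1) / 2) = \<alpha> 2 * hidden_bump \<alpha> \<beta> \<gamma> x + \<beta> 2 * fractal_bump \<gamma> x"
proof -
  have "fractal_bump \<gamma> (x - 1) = 0" "fractal_bump \<gamma> (x + 1) = 0"
    using x by (auto intro!: bump_zero[OF bump_fractal_bump[OF \<gamma>]])
  then show "hidden_bump \<alpha> \<beta> \<gamma> (x / 2) = \<alpha> 1 * hidden_bump \<alpha> \<beta> \<gamma> x + \<beta> 1 * fractal_bump \<gamma> x"
      "hidden_bump \<alpha> \<beta> \<gamma> ((x + 1) / 2) = \<alpha> 2 * hidden_bump \<alpha> \<beta> \<gamma> x + \<beta> 2 * fractal_bump \<gamma> x"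
    using self_affine_halves[OF bump_two_scale[OF bump_fractal_bump[OF \<gamma>] bump_fractal_bump[OF \<gamma>]] \<alpha> x,
        of "\<beta> 1" "\<beta> 2"]
    by (simp_all add: hidden_bump_def add_divide_distrib)
qed

lemma hidden_bump_mid: "hidden_bump \<alpha> \<beta> \<gamma> (1 / 2) = 0"
  using hidden_bump_halves(1)[of 1] bump_zero[OF bump_hidden_bump, of 1]
    bump_zero[OF bump_fractal_bump[OF \<gamma>], of 1]
  by simp

end

text \<open>
  The values at \<open>0\<close>, \<open>1/2\<close>, \<open>1\<close> force the affine inhomogeneities to vanish. Then the maximum of
  \<open>\<bar>w\<bar>\<close> is attained at a point where \<open>w\<close> is a factor of modulus below \<open>1\<close> times another
  value of \<open>w\<close>, so it is \<open>0\<close>.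
\<close>

lemma self_affine_zero_unique:
  fixes w :: "real \<Rightarrow> real"
  assumes cont: "continuous_on {0..1} w"
    and zero: "w 0 = 0" "w (1 / 2) = 0" "w 1 = 0"
    and a: "\<bar>a 1\<bar> < 1" "\<bar>a 2\<bar> < 1"
    and left: "\<And>x. x \<in> {0..1} \<Longrightarrow> w (x / 2) = a (1::nat) * w x + (s1 + t1 * x)"
    and right: "\<And>x. x \<in> {0..1} \<Longrightarrow> w ((x + 1) / 2) = a 2 * w x + (s2 + t2 * x)"
    and x: "x \<in> {0..1}"
  shows "w x = 0"
proof -
  have st: "s1 = 0" "t1 = 0" "s2 = 0" "t2 = 0"
    using left[of 0] left[of 1] right[of 0] right[of 1] zero by auto
  have "\<exists>m\<in>{0..1}. \<forall>y\<in>{0..1}. \<bar>w y\<bar> \<le> \<bar>w m\<bar>"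
    by (rule continuous_attains_sup) (auto intro!: continuous_intros cont)
  then obtain m where m: "m \<in> {0..1}" "\<And>y. y \<in> {0..1} \<Longrightarrow> \<bar>w y\<bar> \<le> \<bar>w m\<bar>"
    by blast
  have shrink: "w m = 0" if "w m = c * w y" "\<bar>c\<bar> < 1" "y \<in> {0..1}" for c y
  proof (rule ccontr)
    assume "w m \<noteq> 0"
    have "\<bar>w m\<bar> = \<bar>c\<bar> * \<bar>w y\<bar>" using that(1) by (simp add: abs_mult)
    also have "\<dots> \<le> \<bar>c\<bar> * \<bar>w m\<bar>" using m(2)[OF that(3)] by (simp add: mult_left_mono)
    also have "\<dots> < 1 * \<bar>w m\<bar>"
      using that(2) \<open>w m \<noteq> 0\<close> by (intro mult_strict_right_mono) auto
    finally show False by simp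
  qed
  have "w m = 0"
  proof (cases "m \<le> 1 / 2")
    case True
    then show ?thesis using left[of "2 * m"] m(1) st a
      by (intro shrink[of "a 1" "2 * m"]) auto
  next
    case False
    then show ?thesis using right[of "2 * m - 1"] m(1) st a
      by (intro shrink[of "a 2" "2 * m - 1"]) auto
  qed
  then show ?thesis using m(2)[OF x] by simp
qed

section \<open>Square integrable functions\<close>

lemma L2_mult_integrable:
  assumes "g \<in> L2_space" "h \<in> L2_space"
  shows "integrable lborel (\<lambda>x. g x * h x)"
proof (rule Bochner_Integration.integrable_bound)
  show "integrable lborel (\<lambda>x. (g x)\<^sup>2 + (h x)\<^sup>2)"
    using assms by (simp add: L2_space_def)
  show "(\<lambda>x. g x * h x) \<in> borel_measurable lborel"
    using assms by (auto simp: L2_space_def intro: borel_measurable_times)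
  have "\<bar>g x * h x\<bar> \<le> (g x)\<^sup>2 + (h x)\<^sup>2" for x
  proof -
    have "2 * (\<bar>g x\<bar> * \<bar>h x\<bar>) \<le> (g x)\<^sup>2 + (h x)\<^sup>2"
      using sum_squares_bound[of "\<bar>g x\<bar>" "\<bar>h x\<bar>"] by simp
    moreover have "0 \<le> \<bar>g x\<bar> * \<bar>h x\<bar>" by simp
    ultimately show ?thesis unfolding abs_mult by linarith
  qed
  then show "AE x in lborel. norm (g x * h x) \<le> norm ((g x)\<^sup>2 + (h x)\<^sup>2)"
    by simp
qed

lemma L2_C0_of_compact_support:
  assumes g: "continuous_on UNIV g" and zero: "\<And>x. x \<notin> {a..b} \<Longrightarrow> g x = 0"
  shows "g \<in> L2_space \<inter> C0_space"
proof
  have "set_integrable lborel {a..b} (\<lambda>x. (g x)\<^sup>2)"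
    by (intro borel_integrable_atLeastAtMost' continuous_intros continuous_on_subset[OF g]) auto
  moreover have "(\<lambda>x. indicator {a..b} x *\<^sub>R (g x)\<^sup>2) = (\<lambda>x. (g x)\<^sup>2)"
    using zero by (auto simp: indicator_def fun_eq_iff)
  ultimately show "g \<in> L2_space"
    using borel_measurable_continuous_onI[OF g] by (simp add: L2_space_def set_integrable_def)
  have "eventually (\<lambda>x. g x = 0) at_infinity"
    unfolding eventually_at_infinity
    by (rule exI[of _ "\<bar>a\<bar> + \<bar>b\<bar> + 1"]) (auto intro!: zero)
  then show "g \<in> C0_space"
    using g by (simp add: C0_space_def tendsto_eventually)
qed

lemma L2_C0_translate:
  assumes "g \<in> L2_space \<inter> C0_space"
  shows "translate l g \<in> L2_space \<inter> C0_space"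
proof
  have g: "g \<in> borel_measurable borel" "integrable lborel (\<lambda>x. (g x)\<^sup>2)" "continuous_on UNIV g"
    "(g \<longlongrightarrow> 0) at_infinity"
    using assms by (auto simp: L2_space_def C0_space_def)
  have "integrable lborel (\<lambda>x. (g (- of_int l + 1 * x))\<^sup>2)"
    using lborel_integrable_real_affine[OF g(2), of 1 "- of_int l"] by simp
  moreover have "(\<lambda>x. g (x - of_int l)) \<in> borel_measurable borel"
    using g(1) by measurable
  ultimately show "translate l g \<in> L2_space"
    by (simp add: L2_space_def translate_def)
  have "((\<lambda>x. g (x - of_int l)) \<longlongrightarrow> 0) at_infinity"
    unfolding tendsto_iff eventually_at_infinity
  proof (intro allI impI)
    fix e :: real
    assume "0 < e"
    then obtain B where "\<forall>x. B \<le> norm x \<longrightarrow> dist (g x) 0 < e"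
      using g(4) unfolding tendsto_iff eventually_at_infinity by blast
    then have "\<forall>x. B + \<bar>of_int l\<bar> \<le> norm x \<longrightarrow> dist (g (x - of_int l)) 0 < e" by auto
    then show "\<exists>B. \<forall>x. B \<le> norm x \<longrightarrow> dist (g (x - of_int l)) 0 < e" by blast
  qed
  moreover have "continuous_on UNIV (\<lambda>x. g (x - of_int l))"
    by (rule continuous_on_compose2[OF g(3)]) (auto intro: continuous_intros)
  ultimately show "translate l g \<in> C0_space"
    by (simp add: C0_space_def translate_def)
qed

lemma V0_translate:
  assumes "g \<in> V0 \<alpha> \<beta> \<gamma>"
  shows "translate l g \<in> V0 \<alpha> \<beta> \<gamma>"
proof -
  obtain f where f: "f \<in> V0_tilde \<alpha> \<beta> \<gamma>" "g = fst \<circ> f" using assms by (auto simp: V0_def)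
  define f' where "f' x = f (x - of_int l)" for x
  have comp: "fst \<circ> f' = translate l (fst \<circ> f)" "snd \<circ> f' = translate l (snd \<circ> f)"
    by (auto simp: f'_def translate_def fun_eq_iff)
  have "f' \<in> S0_tilde \<alpha> \<beta> \<gamma>"
    unfolding S0_tilde_def
  proof (intro CollectI allI)
    fix i :: int
    have "\<exists>h\<in>S0 \<alpha> \<beta> \<gamma>. \<forall>x\<in>{0..<1}. f (x + of_int (i - l) - 1) = h x"
      using f(1) unfolding V0_tilde_def S0_tilde_def by blast
    then show "\<exists>h\<in>S0 \<alpha> \<beta> \<gamma>. \<forall>x\<in>{0..<1}. f' (x + of_int i - 1) = h x"
      by (simp add: f'_def algebra_simps)
  qed
  then have "f' \<in> V0_tilde \<alpha> \<beta> \<gamma>"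
    using f(1) unfolding V0_tilde_def comp mem_Collect_eq
    by (intro conjI) (simp, (rule L2_C0_translate, simp)+)
  then show ?thesis
    unfolding V0_def f(2) comp(1)[symmetric] by (rule imageI)
qed

section \<open>The space \<open>V0\<close> on unit intervals\<close>

lemma affine_plus_fractal_bump_in_S0:
  assumes \<alpha>: "\<bar>\<alpha> 1\<bar> < 1" "\<bar>\<alpha> 2\<bar> < 1"
  shows "(\<lambda>x. (p + q * x + c * fractal_bump \<alpha> x, 0)) \<in> S0 \<alpha> \<beta> \<gamma>"
proof -
  let ?\<Lambda> = "fractal_bump \<alpha>"
  define y where "y k = p + q * (real k / 2) + (if k = 1 then c else 0)" for k :: nat
  define P where "P n = (if n = 1 then [:p - \<alpha> 1 * p, q / 2 + c - \<alpha> 1 * q:]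
     else [:p + q / 2 + c - \<alpha> 2 * p, q / 2 - c - \<alpha> 2 * q:])" for n :: nat
  have "continuous_on {0..1} ?\<Lambda>"
    using continuous_on_subset[OF bump_continuous[OF bump_fractal_bump[OF \<alpha>]]] by blast
  then have "continuous_on {0..1} (\<lambda>x. (p + q * x + c * ?\<Lambda> x, 0::real))"
    by (intro continuous_intros)
  moreover have "CHFIF_polys \<alpha> \<beta> \<gamma> y (\<lambda>_. 0) P (\<lambda>_. 0)"
    by (auto simp: CHFIF_polys_def y_def P_def algebra_simps)
  moreover have "p + q * L_map n x + c * ?\<Lambda> (L_map n x) = \<alpha> n * (p + q * x + c * ?\<Lambda> x) + poly (P n) x"
    if "n \<in> {1, 2}" "x \<in> {0..1}" for n x
  proof -
    have L: "L_map 1 x = x / 2" "L_map 2 x = (x + 1) / 2" by (auto simp: L_map_def)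
    from that(1) consider "n = 1" | "n = 2" by blast
    then show ?thesis
    proof cases
      case 1
      show ?thesis
        unfolding 1 L fractal_bump_halves[OF \<alpha> that(2)] by (simp add: P_def algebra_simps)
    next
      case 2
      show ?thesis
        unfolding 2 L fractal_bump_halves[OF \<alpha> that(2)]
        by (simp add: P_def algebra_simps add_divide_distrib)
    qed
  qed
  ultimately show ?thesis
    unfolding S0_def is_CHFIF_def mem_Collect_eq
    by - (rule exI[of _ y], rule exI[of _ "\<lambda>_. 0"], rule conjI, assumption,
          rule exI[of _ P], rule exI[of _ "\<lambda>_. 0"], simp)
qed

text \<open>
  Membership in \<open>V0\<close> for functions assembled from tents and fractal bumps, with hidden
  component \<open>0\<close>.
\<close>

lemma V0_memI:
  assumes \<alpha>: "\<bar>\<alpha> 1\<bar> < 1" "\<bar>\<alpha> 2\<bar> < 1"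
    and cont: "continuous_on UNIV g" and zero: "\<And>x. x \<notin> {a..b} \<Longrightarrow> g x = 0"
    and pieces: "\<And>m::int. \<exists>p q c. \<forall>x\<in>{0..<1}. g (x + of_int m) = p + q * x + c * fractal_bump \<alpha> x"
  shows "g \<in> V0 \<alpha> \<beta> \<gamma>"
proof -
  define f where "f x = (g x, 0::real)" for x
  have "f \<in> S0_tilde \<alpha> \<beta> \<gamma>"
    unfolding S0_tilde_def
  proof (intro CollectI allI)
    fix i :: int
    obtain p q c where pqc: "\<forall>x\<in>{0..<1}. g (x + of_int (i - 1)) = p + q * x + c * fractal_bump \<alpha> x"
      using pieces[of "i - 1"] by blast
    show "\<exists>h\<in>S0 \<alpha> \<beta> \<gamma>. \<forall>x\<in>{0..<1}. f (x + of_int i - 1) = h x"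
      by (rule bexI[OF _ affine_plus_fractal_bump_in_S0[OF \<alpha>, of p q c]])
         (use pqc in \<open>simp add: f_def algebra_simps\<close>)
  qed
  moreover have "fst \<circ> f = g" "snd \<circ> f = (\<lambda>_. 0)" by (auto simp: f_def)
  moreover have "(\<lambda>_. 0) \<in> L2_space \<inter> C0_space"
    by (rule L2_C0_of_compact_support[of _ 0 0]) auto
  ultimately have "f \<in> V0_tilde \<alpha> \<beta> \<gamma>"
    using L2_C0_of_compact_support[OF cont zero] by (simp add: V0_tilde_def)
  then show ?thesis unfolding V0_def using \<open>fst \<circ> f = g\<close> by blast
qed

text \<open>
  The hidden component comes first: it is an affine function plus \<open>d\<close> times its bump, with \<open>d\<close> the
  deviation of its midpoint value from the mean of its end values. Fed into the equation for the
  first component, the affine part of \<open>f\<^sub>2\<close> only contributes an affine term, and \<open>d U\<close> absorbs the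
  rest. In both cases the interpolation polynomials need not be known: the remainder vanishes by
  \<open>self_affine_zero_unique\<close>, whatever the affine inhomogeneity.
\<close>

lemma S0_local_form:
  assumes \<alpha>: "\<bar>\<alpha> 1\<bar> < 1" "\<bar>\<alpha> 2\<bar> < 1" and \<gamma>: "\<bar>\<gamma> 1\<bar> < 1" "\<bar>\<gamma> 2\<bar> < 1"
    and f: "f \<in> S0 \<alpha> \<beta> \<gamma>"
  shows "\<exists>e d. \<forall>x\<in>{0..1}. fst (f x) =
    (1 - x) * fst (f 0) + x * fst (f 1) + e * fractal_bump \<alpha> x + d * hidden_bump \<alpha> \<beta> \<gamma> x"
proof -
  let ?\<Lambda> = "fractal_bump \<alpha>" and ?Z = "fractal_bump \<gamma>" and ?U = "hidden_bump \<alpha> \<beta> \<gamma>"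
  obtain y z p q where cont: "continuous_on {0..1} f" and pq: "CHFIF_polys \<alpha> \<beta> \<gamma> y z p q"
    and eq: "\<And>n x. n \<in> {1, 2} \<Longrightarrow> x \<in> {0..1} \<Longrightarrow>
         fst (f (L_map n x)) = \<alpha> n * fst (f x) + \<beta> n * snd (f x) + poly (p n) x \<and>
         snd (f (L_map n x)) = \<gamma> n * snd (f x) + poly (q n) x"
    using f unfolding S0_def is_CHFIF_def by blast
  have affine: "\<exists>s t. \<forall>x. poly r x = s + t * x" if deg: "degree r \<le> 1" for r :: "real poly"
  proof -
    have "poly r x = coeff r 0 + coeff r 1 * x" for x
      using poly_altdef[of r x] coeff_eq_0[of r 1] deg by (cases "degree r") auto
    then show ?thesis by blast
  qed
  obtain s1 t1 s2 t2 where p: "\<And>x. poly (p 1) x = s1 + t1 * x" "\<And>x. poly (p 2) x = s2 + t2 * x"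
    using pq affine[of "p 1"] affine[of "p 2"] by (auto simp: CHFIF_polys_def)
  obtain v1 w1 v2 w2 where q: "\<And>x. poly (q 1) x = v1 + w1 * x" "\<And>x. poly (q 2) x = v2 + w2 * x"
    using pq affine[of "q 1"] affine[of "q 2"] by (auto simp: CHFIF_polys_def)
  have f1: "fst (f (x / 2)) = \<alpha> 1 * fst (f x) + \<beta> 1 * snd (f x) + (s1 + t1 * x)"
      "fst (f ((x + 1) / 2)) = \<alpha> 2 * fst (f x) + \<beta> 2 * snd (f x) + (s2 + t2 * x)"
    and f2: "snd (f (x / 2)) = \<gamma> 1 * snd (f x) + (v1 + w1 * x)"
      "snd (f ((x + 1) / 2)) = \<gamma> 2 * snd (f x) + (v2 + w2 * x)" if "x \<in> {0..1}" for x
    using eq[of 1 x] eq[of 2 x] that p q by (auto simp: L_map_def)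
  have bumps: "bump ?\<Lambda>" "bump ?Z" "bump ?U"
    by (intro bump_fractal_bump bump_hidden_bump \<alpha> \<gamma>)+
  then have cont_bumps: "continuous_on {0..1} ?\<Lambda>" "continuous_on {0..1} ?Z" "continuous_on {0..1} ?U"
    by (auto intro: continuous_on_subset[OF bump_continuous])
  have ends: "?\<Lambda> 0 = 0" "?\<Lambda> 1 = 0" "?Z 0 = 0" "?Z 1 = 0" "?U 0 = 0" "?U 1 = 0"
    using bumps[THEN bump_zero] by auto
  note mids = fractal_bump_mid[OF \<alpha>] fractal_bump_mid[OF \<gamma>] hidden_bump_mid[OF \<alpha> \<gamma>]

  define A where "A = snd (f 0)"
  define B where "B = snd (f 1) - snd (f 0)"
  define d where "d = snd (f (1 / 2)) - (A + B / 2)"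
  have f2_form: "snd (f x) = A + B * x + d * ?Z x" if x: "x \<in> {0..1}" for x
  proof -
    define w where "w x = snd (f x) - (A + B * x + d * ?Z x)" for x
    have "w x = 0"
    proof (rule self_affine_zero_unique[where w = w and a = \<gamma> and x = x])
      show "continuous_on {0..1} w"
        unfolding w_def by (intro continuous_intros cont cont_bumps)
      show "w (x / 2) = \<gamma> 1 * w x + ((v1 + \<gamma> 1 * A - A) + (w1 + \<gamma> 1 * B - B / 2 - d) * x)"
        if "x \<in> {0..1}" for x
        unfolding w_def fractal_bump_halves(1)[OF \<gamma> that] f2(1)[OF that]
        by (simp add: algebra_simps)
      show "w ((x + 1) / 2) = \<gamma> 2 * w x
          + ((v2 + \<gamma> 2 * A - A - B / 2 - d) + (w2 + \<gamma> 2 * B - B / 2 + d) * x)"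
        if "x \<in> {0..1}" for x
        unfolding w_def fractal_bump_halves(2)[OF \<gamma> that] f2(2)[OF that]
        by (simp add: algebra_simps add_divide_distrib)
    qed (use x \<gamma> ends mids in \<open>auto simp: w_def A_def B_def d_def\<close>)
    then show ?thesis by (simp add: w_def)
  qed

  define C where "C = fst (f 0)"
  define D where "D = fst (f 1) - fst (f 0)"
  define e where "e = fst (f (1 / 2)) - (C + D / 2)"
  have f1_form: "fst (f x) = C + D * x + e * ?\<Lambda> x + d * ?U x" if x: "x \<in> {0..1}" for x
  proof -
    define w where "w x = fst (f x) - (C + D * x + e * ?\<Lambda> x + d * ?U x)" for x
    have "w x = 0"
    proof (rule self_affine_zero_unique[where w = w and a = \<alpha> and x = x])
      show "continuous_on {0..1} w"
        unfolding w_def by (intro continuous_intros cont cont_bumps)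
      show "w (x / 2) = \<alpha> 1 * w x
          + ((s1 + \<beta> 1 * A + \<alpha> 1 * C - C) + (t1 + \<beta> 1 * B + \<alpha> 1 * D - D / 2 - e) * x)"
        if "x \<in> {0..1}" for x
        unfolding w_def fractal_bump_halves(1)[OF \<alpha> that] hidden_bump_halves(1)[OF \<alpha> \<gamma> that]
          f1(1)[OF that] f2_form[OF that]
        by (simp add: algebra_simps)
      show "w ((x + 1) / 2) = \<alpha> 2 * w x
          + ((s2 + \<beta> 2 * A + \<alpha> 2 * C - C - D / 2 - e) + (t2 + \<beta> 2 * B + \<alpha> 2 * D - D / 2 + e) * x)"
        if "x \<in> {0..1}" for x
        unfolding w_def fractal_bump_halves(2)[OF \<alpha> that] hidden_bump_halves(2)[OF \<alpha> \<gamma> that]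
          f1(2)[OF that] f2_form[OF that]
        by (simp add: algebra_simps add_divide_distrib)
    qed (use x \<alpha> ends mids in \<open>auto simp: w_def C_def D_def e_def\<close>)
    then show ?thesis by (simp add: w_def)
  qed
  have "fst (f x) = (1 - x) * fst (f 0) + x * fst (f 1) + e * ?\<Lambda> x + d * ?U x"
    if "x \<in> {0..1}" for x
    unfolding f1_form[OF that] by (simp add: C_def D_def algebra_simps)
  then show ?thesis by blast
qed

text \<open>
  Membership in \<open>S0_tilde\<close> only controls \<open>h\<close> on the half-open interval; continuity of \<open>h\<close> carries
  the value of the CHFIF at the right end over to \<open>h (m + 1)\<close>.
\<close>

lemma V0_local_form:
  assumes \<alpha>: "\<bar>\<alpha> 1\<bar> < 1" "\<bar>\<alpha> 2\<bar> < 1" and \<gamma>: "\<bar>\<gamma> 1\<bar> < 1" "\<bar>\<gamma> 2\<bar> < 1"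
    and h: "h \<in> V0 \<alpha> \<beta> \<gamma>"
  shows "\<exists>e d. \<forall>x\<in>{0..<1}. h (x + of_int m) =
    (1 - x) * h (of_int m) + x * h (of_int m + 1) + e * fractal_bump \<alpha> x + d * hidden_bump \<alpha> \<beta> \<gamma> x"
proof -
  obtain f where f: "f \<in> S0_tilde \<alpha> \<beta> \<gamma>" "h = fst \<circ> f" and cont: "continuous_on UNIV h"
    using h unfolding V0_def V0_tilde_def C0_space_def by blast
  have "\<exists>s\<in>S0 \<alpha> \<beta> \<gamma>. \<forall>x\<in>{0..<1}. f (x + of_int (m + 1) - 1) = s x"
    using f(1) unfolding S0_tilde_def by blast
  then obtain s where s: "s \<in> S0 \<alpha> \<beta> \<gamma>" and eq: "\<And>x. x \<in> {0..<1} \<Longrightarrow> h (x + of_int m) = fst (s x)"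
    unfolding f(2) comp_def by force
  have cl: "closure {0..<1} = {0..1::real}" by simp
  have "h (1 + of_int m) - fst (s 1) = 0"
  proof (rule continuous_constant_on_closure[where x = 1 and S = "{0..<1}"])
    have "continuous_on UNIV (\<lambda>x. h (x + of_int m))"
      by (rule continuous_on_compose2[OF cont]) (auto intro: continuous_intros)
    then have "continuous_on {0..1} (\<lambda>x. h (x + of_int m))"
      by (rule continuous_on_subset) simp
    moreover have "continuous_on {0..1} s" using s by (auto simp: S0_def is_CHFIF_def)
    ultimately show "continuous_on (closure {0..<1}) (\<lambda>x. h (x + of_int m) - fst (s x))"
      unfolding cl by (intro continuous_intros)
  qed (use eq cl in \<open>simp_all\<close>)
  then have ends: "h (of_int m + 1) = fst (s 1)" "h (of_int m) = fst (s 0)"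
    using eq[of 0] by (simp_all add: add.commute)
  obtain e d where form: "\<forall>x\<in>{0..1}. fst (s x) =
    (1 - x) * fst (s 0) + x * fst (s 1) + e * fractal_bump \<alpha> x + d * hidden_bump \<alpha> \<beta> \<gamma> x"
    using S0_local_form[OF \<alpha> \<gamma> s] by blast
  have "h (x + of_int m) = (1 - x) * h (of_int m) + x * h (of_int m + 1)
      + e * fractal_bump \<alpha> x + d * hidden_bump \<alpha> \<beta> \<gamma> x" if "x \<in> {0..<1}" for x
    unfolding ends eq[OF that] using that by (intro form[rule_format]) simp
  then show ?thesis by blast
qed

lemma tent_on_unit_interval:
  assumes "x \<in> {0..<1}"
  shows "tent (x + of_int m - of_int i) = (if i = m then 1 - x else if i = m + 1 then x else 0)"
proof -
  consider "i = m" | "i = m + 1" | "i \<le> m - 1" | "m + 2 \<le> i" by linarith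
  then show ?thesis
  proof cases
    case 3
    then have "real_of_int i \<le> of_int (m - 1)" by (simp only: of_int_le_iff)
    then have "1 \<le> x + of_int m - of_int i" using assms by simp
    then show ?thesis using 3 by (simp add: tent_def)
  next
    case 4
    then have "real_of_int (m + 2) \<le> of_int i" by (simp only: of_int_le_iff)
    then have "x + of_int m - of_int i \<le> - 1" using assms by simp
    then show ?thesis using 4 by (simp add: tent_def)
  qed (use assms in \<open>simp_all add: tent_def\<close>)
qed

lemma bump_on_unit_interval:
  assumes b: "bump b" and x: "x \<in> {0..<1}"
  shows "b (x + of_int m - of_int i) = (if i = m then b x else 0)"
proof (cases "i = m")
  case False
  then have "i \<le> m - 1 \<or> m + 1 \<le> i" by linarith
  then have "real_of_int i \<le> of_int (m - 1) \<or> real_of_int (m + 1) \<le> of_int i"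
    by (simp only: of_int_le_iff)
  then have "x + of_int m - of_int i \<le> 0 \<or> 1 \<le> x + of_int m - of_int i" using x by auto
  then show ?thesis using bump_zero[OF b] False by simp
qed simp

text \<open>
  On \<open>[m, m + 1)\<close> only the tents at \<open>m\<close> and \<open>m + 1\<close> and the bump starting at \<open>m\<close> are alive, so
  sums of translates collapse to at most two terms there.
\<close>

lemma tent_sum_on_unit_interval:
  fixes c :: "int \<Rightarrow> real"
  assumes "finite A" "x \<in> {0..<1}"
  shows "(\<Sum>i\<in>A. c i * tent (x + of_int m - of_int i)) =
    (1 - x) * (if m \<in> A then c m else 0) + x * (if m + 1 \<in> A then c (m + 1) else 0)"
proof -
  have "(\<Sum>i\<in>A. c i * tent (x + of_int m - of_int i)) =
      (\<Sum>i\<in>A. (if i = m then c i * (1 - x) else 0) + (if i = m + 1 then c i * x else 0))"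
    by (rule sum.cong) (simp_all add: tent_on_unit_interval[OF assms(2)])
  then show ?thesis using assms(1) by (simp add: sum.distrib)
qed

lemma bump_sum_on_unit_interval:
  fixes c :: "int \<Rightarrow> real"
  assumes "finite A" "bump b" "x \<in> {0..<1}"
  shows "(\<Sum>i\<in>A. c i * b (x + of_int m - of_int i)) = (if m \<in> A then c m else 0) * b x"
proof -
  have "(\<Sum>i\<in>A. c i * b (x + of_int m - of_int i)) = (\<Sum>i\<in>A. if i = m then c i * b x else 0)"
    by (rule sum.cong) (simp_all add: bump_on_unit_interval[OF assms(2,3)])
  then show ?thesis using assms(1) by simp
qed

text \<open>
  Gluing the local forms: two neighbouring unit intervals share the tent at their common
  integer, because members of \<open>V0\<close> are continuous. Hence \<open>[0, n)\<close> costs only \<open>3 n + 1\<close> functions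
  instead of the \<open>4 n\<close> of independent pieces, and this saving is what the dimension count in
  \<open>W0_nontrivial\<close> lives on.
\<close>

lemma V0_expansion:
  fixes n :: int
  assumes \<alpha>: "\<bar>\<alpha> 1\<bar> < 1" "\<bar>\<alpha> 2\<bar> < 1" and \<gamma>: "\<bar>\<gamma> 1\<bar> < 1" "\<bar>\<gamma> 2\<bar> < 1"
    and h: "h \<in> V0 \<alpha> \<beta> \<gamma>"
  shows "\<exists>e d. \<forall>x\<in>{0..<of_int n}. h x =
     (\<Sum>j\<in>{0..n}. h (of_int j) * translate j tent x)
   + (\<Sum>j\<in>{0..<n}. e j * translate j (fractal_bump \<alpha>) x)
   + (\<Sum>j\<in>{0..<n}. d j * translate j (hidden_bump \<alpha> \<beta> \<gamma>) x)"
proof -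
  have "\<forall>m. \<exists>e d. \<forall>x\<in>{0..<1}. h (x + of_int m) = (1 - x) * h (of_int m) + x * h (of_int m + 1)
      + e * fractal_bump \<alpha> x + d * hidden_bump \<alpha> \<beta> \<gamma> x"
    using V0_local_form[OF \<alpha> \<gamma> h] by blast
  then obtain e d where ed: "\<And>m x. x \<in> {0..<1} \<Longrightarrow>
      h (x + of_int m) = (1 - x) * h (of_int m) + x * h (of_int m + 1)
      + e m * fractal_bump \<alpha> x + d m * hidden_bump \<alpha> \<beta> \<gamma> x"
    by metis
  show ?thesis
  proof (intro exI ballI)
    fix y :: real
    assume y: "y \<in> {0..<of_int n}"
    define m where "m = \<lfloor>y\<rfloor>"
    define x where "x = y - of_int m"
    have x: "x \<in> {0..<1}" unfolding x_def m_def by simp linarith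
    have m: "0 \<le> m" "m < n" using y by (simp_all add: m_def floor_less_iff)
    have y_eq: "y = x + of_int m" by (simp add: x_def)
    show "h y = (\<Sum>j\<in>{0..n}. h (of_int j) * translate j tent y)
       + (\<Sum>j\<in>{0..<n}. e j * translate j (fractal_bump \<alpha>) y)
       + (\<Sum>j\<in>{0..<n}. d j * translate j (hidden_bump \<alpha> \<beta> \<gamma>) y)"
      unfolding y_eq translate_def ed[OF x]
        tent_sum_on_unit_interval[OF finite_atLeastAtMost_int x]
        bump_sum_on_unit_interval[OF finite_atLeastLessThan_int bump_fractal_bump[OF \<alpha>] x]
        bump_sum_on_unit_interval[OF finite_atLeastLessThan_int bump_hidden_bump[OF \<alpha> \<gamma>] x]
      using m by simp
  qed
qed

section \<open>A non-zero element of the wavelet space\<close>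

text \<open>
  The dimension count on \<open>[0, 3]\<close>. The dilated functions \<open>tent (2 x - i)\<close>, \<open>1 \<le> i \<le> 5\<close>, and
  \<open>fractal_bump \<alpha> (2 x - i)\<close>, \<open>0 \<le> i \<le> 5\<close>, are \<open>11\<close> linearly independent members of \<open>V (- 1)\<close>
  supported in \<open>[0, 3]\<close>, whereas \<open>V0\<close> restricted to \<open>[0, 3)\<close> is spanned by \<open>10\<close> functions. The
  interval is the shortest one starting at \<open>0\<close> with integer length \<open>n\<close> for which the \<open>4 n - 1\<close>
  unknowns outnumber the \<open>3 n + 1\<close> equations.
\<close>

lemma W0_nontrivial:
  assumes \<alpha>: "\<bar>\<alpha> 1\<bar> < 1" "\<bar>\<alpha> 2\<bar> < 1" and \<gamma>: "\<bar>\<gamma> 1\<bar> < 1" "\<bar>\<gamma> 2\<bar> < 1"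
  shows "\<exists>g\<in>W \<alpha> \<beta> \<gamma> 0. g \<noteq> (\<lambda>x. 0)"
proof -
  let ?\<Lambda> = "fractal_bump \<alpha>" and ?U = "hidden_bump \<alpha> \<beta> \<gamma>"
  have bumps: "bump ?\<Lambda>" "bump ?U"
    by (intro bump_fractal_bump bump_hidden_bump \<alpha> \<gamma>)+
  \<comment> \<open>\<open>Inl\<close> indexes the tents and \<open>Inr\<close> the bumps, both before dilation and hence in \<open>[0, 6]\<close>.\<close>
  define G where "G k = (case k of Inl i \<Rightarrow> translate i tent | Inr i \<Rightarrow> translate i ?\<Lambda>)"
    for k :: "int + int"
  define I where "I = {1..5::int} <+> {0..<6::int}"
  define B where "B = (\<lambda>j. translate j tent) ` {0..3} \<union> (\<lambda>j. translate j ?\<Lambda>) ` {0..<3}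
     \<union> (\<lambda>j. translate j ?U) ` {0..<3}"
  have finI: "finite I" and finB: "finite B" by (auto simp: I_def B_def)
  have "card B \<le> card {0..3::int} + card {0..<3::int} + card {0..<3::int}"
    unfolding B_def by (intro order_trans[OF card_Un_le] add_mono card_image_le) auto
  also have "\<dots> < card I" by (simp add: I_def card_Plus)
  finally obtain c where c_nz: "\<exists>k\<in>I. c k \<noteq> 0"
    and c_orth: "\<And>b. b \<in> B \<Longrightarrow> (\<Sum>k\<in>I. c k * L2_inner (\<lambda>x. G k (2 * x)) b) = 0"
    using underdetermined_system_nontrivial[OF finB finI, of "\<lambda>k. L2_inner (\<lambda>x. G k (2 * x))"]
    by blast
  define \<Gamma> where "\<Gamma> x = (\<Sum>k\<in>I. c k * G k x)" for x
  define g where "g x = \<Gamma> (2 * x)" for x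
  define C where "C i = (if i \<in> {1..5} then c (Inl i) else 0)" for i
  define E where "E i = (if i \<in> {0..<6} then c (Inr i) else 0)" for i

  have \<Gamma>_local: "\<Gamma> (x + of_int m) = (1 - x) * C m + x * C (m + 1) + E m * ?\<Lambda> x"
    if x: "x \<in> {0..<1}" for x m
    unfolding \<Gamma>_def I_def G_def C_def E_def
    by (simp only: sum.Plus finite_atLeastAtMost_int finite_atLeastLessThan_int sum.case translate_def
        comp_def bump_sum_on_unit_interval[OF finite_atLeastLessThan_int bumps(1) x]
        tent_sum_on_unit_interval[OF finite_atLeastAtMost_int x])

  have cont_tr: "continuous_on UNIV (translate i f)" if "continuous_on UNIV f" for i f
    unfolding translate_def
    by (rule continuous_on_compose2[OF that]) (auto intro: continuous_intros)
  have cont_basis: "continuous_on UNIV tent" "continuous_on UNIV ?\<Lambda>" "continuous_on UNIV ?U"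
    using continuous_tent bumps[THEN bump_continuous] by auto
  have contG: "continuous_on UNIV (G k)" for k
    by (cases k) (simp_all add: G_def cont_tr cont_basis)
  have contG2: "continuous_on UNIV (\<lambda>x. G k (2 * x))" for k
    by (rule continuous_on_compose2[OF contG]) (auto intro: continuous_intros)
  have G_zero: "G k x = 0" if "k \<in> I" "x \<notin> {0..6}" for k x
  proof (cases k)
    case (Inl i)
    then have "1 \<le> real_of_int i" "real_of_int i \<le> 5" using that(1) by (auto simp: I_def)
    then show ?thesis using that(2) by (auto simp: Inl G_def translate_def tent_def)
  next
    case (Inr i)
    then have "i \<in> {0..5}" using that(1) by (auto simp: I_def)
    then have "0 \<le> real_of_int i" "real_of_int i \<le> 5" by auto
    then have "x - of_int i \<le> 0 \<or> 1 \<le> x - of_int i" using that(2) by auto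
    then show ?thesis by (simp add: Inr G_def translate_def bump_zero[OF bumps(1)])
  qed
  have \<Gamma>_zero: "\<Gamma> x = 0" if "x \<notin> {0..6}" for x
    using G_zero that by (simp add: \<Gamma>_def)
  have "continuous_on UNIV \<Gamma>"
    unfolding \<Gamma>_def by (intro continuous_intros contG)
  then have "\<Gamma> \<in> V0 \<alpha> \<beta> \<gamma>"
  proof (rule V0_memI[OF \<alpha>])
    fix m :: int
    show "\<exists>p q d. \<forall>x\<in>{0..<1}. \<Gamma> (x + of_int m) = p + q * x + d * ?\<Lambda> x"
      by (rule exI[of _ "C m"], rule exI[of _ "C (m + 1) - C m"], rule exI[of _ "E m"])
         (simp add: \<Gamma>_local algebra_simps)
  qed (rule \<Gamma>_zero)
  then have g_V: "g \<in> V \<alpha> \<beta> \<gamma> (0 - 1)"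
    by (simp add: V_def g_def[abs_def] power_int_minus)

  \<comment> \<open>The bumps vanish at the integers, which isolates the tent coefficients; the half-integers
    then give the bump coefficients.\<close>
  have g_nz: "g \<noteq> (\<lambda>x. 0)"
  proof
    assume "g = (\<lambda>x. 0)"
    then have \<Gamma>0: "\<Gamma> x = 0" for x
      unfolding g_def fun_eq_iff by (metis field_sum_of_halves mult_2)
    have C0: "C m = 0" for m
      using \<Gamma>_local[of 0 m] \<Gamma>0 bump_zero[OF bumps(1), of 0] by simp
    have E0: "E m = 0" for m
      using \<Gamma>_local[of "1 / 2" m] \<Gamma>0 C0 fractal_bump_mid[OF \<alpha>] by simp
    show False
      using c_nz C0 E0 unfolding I_def C_def E_def by (metis PlusE)
  qed

  have L2G: "(\<lambda>x. G k (2 * x)) \<in> L2_space" if "k \<in> I" for k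
    using L2_C0_of_compact_support[OF contG2, where a = 0 and b = 3] G_zero[OF that] by auto
  have L2tr: "translate j f \<in> L2_space" if "f \<in> {tent, ?\<Lambda>, ?U}" for j f
  proof -
    have "f x = 0" if "x \<notin> {- 1..1}" for x
      using \<open>f \<in> _\<close> that bumps[THEN bump_zero] by (auto simp: tent_def)
    moreover have "continuous_on UNIV f" using that cont_basis by auto
    ultimately show ?thesis using L2_C0_translate[OF L2_C0_of_compact_support] by blast
  qed
  have L2B: "b \<in> L2_space" if "b \<in> B" for b
    using that L2tr by (auto simp: B_def)
  have intgb: "integrable lborel (\<lambda>x. g x * b x)" and orthb: "L2_inner g b = 0" if b: "b \<in> B" for b
  proof -
    have eq: "g x * b x = (\<Sum>k\<in>I. c k * (G k (2 * x) * b x))" for x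
      by (simp add: g_def \<Gamma>_def sum_distrib_right mult.assoc)
    have int: "integrable lborel (\<lambda>x. c k * (G k (2 * x) * b x))" if "k \<in> I" for k
      by (intro integrable_mult_right L2_mult_integrable L2G[OF that] L2B[OF b])
    then show "integrable lborel (\<lambda>x. g x * b x)"
      unfolding eq by (rule Bochner_Integration.integrable_sum)
    have "L2_inner g b = (\<Sum>k\<in>I. LINT x|lborel. c k * (G k (2 * x) * b x))"
      unfolding L2_inner_def eq by (rule Bochner_Integration.integral_sum[OF int])
    then show "L2_inner g b = 0"
      using c_orth[OF b] by (simp add: L2_inner_def)
  qed

  have "L2_inner g h = 0" if h: "h \<in> V0 \<alpha> \<beta> \<gamma>" for h
  proof -
    obtain e d where h_eq: "\<And>x. x \<in> {0..<3} \<Longrightarrow> h x =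
       (\<Sum>j\<in>{0..3}. h (of_int j) * translate j tent x)
     + (\<Sum>j\<in>{0..<3}. e j * translate j ?\<Lambda> x) + (\<Sum>j\<in>{0..<3}. d j * translate j ?U x)"
      using V0_expansion[OF \<alpha> \<gamma> h, of 3] by auto
    \<comment> \<open>The expansion of \<open>h\<close> is only valid on \<open>[0, 3)\<close>, so the end point needs \<open>g 3 = 0\<close> as well.\<close>
    have g_off: "g x = 0" if "x \<notin> {0..<3}" for x
    proof (cases "x = 3")
      case True
      show ?thesis
        using \<Gamma>_local[of 0 6] bump_zero[OF bumps(1), of 0] by (simp add: g_def True C_def)
    qed (use that in \<open>auto simp: g_def intro!: \<Gamma>_zero\<close>)
    have gh: "g x * h x = (\<Sum>j\<in>{0..3}. h (of_int j) * (g x * translate j tent x))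
       + (\<Sum>j\<in>{0..<3}. e j * (g x * translate j ?\<Lambda> x))
       + (\<Sum>j\<in>{0..<3}. d j * (g x * translate j ?U x))" for x
    proof (cases "x \<in> {0..<3}")
      case True
      show ?thesis
        unfolding h_eq[OF True] by (simp add: distrib_left sum_distrib_left mult.left_commute)
    qed (simp add: g_off)
    have in_B: "j \<in> {0..3} \<Longrightarrow> translate j tent \<in> B" "j \<in> {0..<3} \<Longrightarrow> translate j ?\<Lambda> \<in> B"
      "j \<in> {0..<3} \<Longrightarrow> translate j ?U \<in> B" for j
      by (auto simp: B_def)
    have sum0: "integrable lborel (\<lambda>x. \<Sum>j\<in>A. r j * (g x * translate j f x)) \<and>
        (LINT x|lborel. (\<Sum>j\<in>A. r j * (g x * translate j f x))) = 0"
      if AB: "\<And>j. j \<in> A \<Longrightarrow> translate j f \<in> B" for A r f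
    proof -
      have int: "integrable lborel (\<lambda>x. r j * (g x * translate j f x))" if "j \<in> A" for j
        by (intro integrable_mult_right intgb AB that)
      have zero: "(LINT x|lborel. r j * (g x * translate j f x)) = 0" if "j \<in> A" for j
        using orthb[OF AB[OF that]] by (simp add: L2_inner_def)
      have "(LINT x|lborel. (\<Sum>j\<in>A. r j * (g x * translate j f x)))
          = (\<Sum>j\<in>A. LINT x|lborel. r j * (g x * translate j f x))"
        by (rule Bochner_Integration.integral_sum[OF int])
      also have "\<dots> = 0" by (simp only: zero sum.neutral_const cong: sum.cong)
      finally show ?thesis
        by (intro conjI Bochner_Integration.integrable_sum int)
    qed
    note tents = sum0[of "{0..3}", OF in_B(1)] and visible = sum0[of "{0..<3}", OF in_B(2)]
      and hidden = sum0[of "{0..<3}", OF in_B(3)]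
    show ?thesis
      unfolding L2_inner_def gh
      by (simp only: Bochner_Integration.integral_add Bochner_Integration.integrable_add
          tents visible hidden add_0)
  qed
  then have "g \<in> W \<alpha> \<beta> \<gamma> 0" using g_V by (simp add: W_def V_zero)
  then show ?thesis using g_nz by blast
qed

theorem theorem4p2:
  fixes \<alpha> \<beta> \<gamma> :: "nat \<Rightarrow> real"
    and \<phi> :: "nat \<Rightarrow> real \<Rightarrow> real"
  assumes "\<And>n. n \<in> {1, 2} \<Longrightarrow> \<bar>\<alpha> n\<bar> < 1"
    and "\<And>n. n \<in> {1, 2} \<Longrightarrow> \<bar>\<gamma> n\<bar> < 1"
    and "\<And>n. n \<in> {1, 2} \<Longrightarrow> \<bar>\<beta> n\<bar> + \<bar>\<gamma> n\<bar> < 1"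
    and "\<And>i. i \<in> {1, 2, 3} \<Longrightarrow> \<phi> i \<in> V0 \<alpha> \<beta> \<gamma>"
    and "orthogonal_scaling_functions \<phi>"
    and "L2_classes (V0 \<alpha> \<beta> \<gamma>) = L2_clos (lin_span {translate l (\<phi> i) |i l. i \<in> {1, 2, 3}})"
  shows "\<exists>\<psi> :: nat \<Rightarrow> real \<Rightarrow> real. \<forall>i\<in>{1, 2, 3}.
           \<psi> i \<in> W \<alpha> \<beta> \<gamma> 0 \<and> \<psi> i \<noteq> (\<lambda>x. 0) \<and>
           (\<forall>j\<in>{1, 2, 3}. \<forall>l. L2_inner (\<psi> i) (translate l (\<phi> j)) = 0)"
proof -
  have "\<bar>\<alpha> 1\<bar> < 1" "\<bar>\<alpha> 2\<bar> < 1" "\<bar>\<gamma> 1\<bar> < 1" "\<bar>\<gamma> 2\<bar> < 1"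
    using assms(1,2) by simp_all
  then obtain g where g: "g \<in> W \<alpha> \<beta> \<gamma> 0" "g \<noteq> (\<lambda>x. 0)"
    using W0_nontrivial by blast
  have "L2_inner g (translate l (\<phi> j)) = 0" if "j \<in> {1, 2, 3}" for j l
    using g(1) V0_translate[OF assms(4)[OF that]] by (auto simp: W_def V_zero)
  with g show ?thesis by (intro exI[of _ "\<lambda>_. g"]) blast
qed

end
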